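(* Let $p\ge 2$, $2\le t\le p$, and set $C_p=\binom{p}{\lfloor p/2\rfloor}$. For $k\ge 3$ let $$\mathrm{R}_1(k,p,t)=\min\left\{p+\frac{h_p(t)+(h_p(t)-1)\log_2(k-1)-1}{4C_p},\ p+\frac{h_p(t)-1}{2C_p}\right\},$$ which is the lower bound in the earlier uniform bound of Katona, Mao, Ozeki and Wang: $\mathrm{R}^{\sharp}_{k,t}(\mathcal B\mid B_p)>\mathrm{R}_1(k,p,t)$ for integers $k\ge3$ and $1\le t-1\le p$. Let $$\mathrm{R}_2(k,p,t)=p+\frac{(h_p(t)-1)(\log_2 k-\log_2 c)}{C_p(1+o(1))}$$ be the lower bound in the new bound $\mathrm{R}^{\sharp}_{k,t}(\mathcal B\mid B_p)\ge \mathrm{R}_2(k,p,t)$ as $k\to\infty$ (valid for $p\ge2$ and $1\le t\le p$), where $c=c(p,2,t)$ is the constant specified in the context and $o(1)\to0$ as $k\to\infty$. The new lower bounds improve upon the earlier uniform bound in the following two senses: (i) $$\lim_{k\to\infty}\frac{\mathrm{R}_2(k,p,t)}{\mathrm{R}_1(k,p,t)}=+\infty,$$ and hence there exists $k_0=k_0(p,t)$ such that $\mathrm{R}_2(k,p,t)>\mathrm{R}_1(k,p,t)$ for all $k>k_0$. (ii) There is a logarithmic lower bound for every finite poset $Q$, whereas the earlier uniform bound applies only to $Q=B_p$ and requires $t\ge2$. Precisely, the logarithmic bound is the following: for every integer $t\ge1$ and every nonempty finite poset $Q$ with $h(Q,t)\ge2$, there is a constant $c_Q=c_Q(t)>0$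 such that $$\mathrm{R}^{\sharp}_{k,t}(\mathcal B\mid Q)\ge\frac{h(Q,t)-1}{|Q|}\bigl(\log_2 k-\log_2 c_Q\bigr)\qquad(k\to\infty).$$
   Context: $B_n=2^{[n]}$ is the Boolean lattice of all subsets of $[n]$ ordered by inclusion, and $\mathcal B=\{B_n:n\ge1\}$. A $t$-chain in a poset is a set of $t$ distinct pairwise comparable elements; $h(Q,t)$ is the number of $t$-chains of a poset $Q$, and $h_p(t)=h(B_p,t)$. An induced copy of $Q$ in $B_n$ is the image of an injection $f:Q\to B_n$ with $f(x)\subseteq f(y)$ if and only if $x\le_Q y$. The strong Boolean Ramsey number $\mathrm{R}^{\sharp}_{k,t}(\mathcal B\mid Q)$ is the smallest $N$ such that every $k$-coloring of the $t$-chains of $B_N$ contains an induced copy of $Q$ all of whose $t$-chains have the same color. Let $f_t^{\sharp}(n,p,2)$ be the minimum number of colors in a coloring of the $t$-chains of $B_n$ such that every induced copy of $B_p$ in $B_n$ uses at least $2$ colors on its $t$-chains. The constant $c=c(p,2,t)$ is the one in the upper bound $$f_t^{\sharp}(n,p,2)\le c\cdot 2^{\frac{(n-p)\binom{p}{\lfloor p/2\rfloor}(1+o(1))}{h_p(t)-1}}\quad\text{for all } n\ge p,$$ where this $o(1)$ tends to $0$ as $n\to\infty$ with $p,t$ fixed. *)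

theory Defs
  imports Complex_Main "HOL-Library.FuncSet" "HOL-Library.Extended_Real"
begin

text \<open>A poset is represented by its reflexive order relation \<open>Q\<close>, with \<open>Partial_order Q\<close>;
  its carrier is \<open>Field Q\<close>. A family \<open>S\<close> of sets is regarded as the poset
  \<open>relation_of (\<subseteq>) S\<close>.\<close>

definition boolean_lattice :: "nat \<Rightarrow> nat set rel"
  where "boolean_lattice n = relation_of (\<subseteq>) (Pow {1..n})"

definition tchains :: "'a rel \<Rightarrow> nat \<Rightarrow> 'a set set"
  where "tchains Q t = {C \<in> Chains Q. finite C \<and> card C = t}"

definition h :: "'a rel \<Rightarrow> nat \<Rightarrow> nat"
  where "h Q t = card (tchains Q t)"

definition hp :: "nat \<Rightarrow> nat \<Rightarrow> nat"
  where "hp p t = h (boolean_lattice p) t"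

definition induced_copies :: "'a rel \<Rightarrow> nat \<Rightarrow> nat set set set"
  where "induced_copies Q n =
    {f ` Field Q | f. f \<in> Field Q \<rightarrow> Pow {1..n} \<and> inj_on f (Field Q) \<and>
       (\<forall>x\<in>Field Q. \<forall>y\<in>Field Q. f x \<subseteq> f y \<longleftrightarrow> (x, y) \<in> Q)}"

text \<open>The smallest \<open>N\<close> is taken as an infimum in \<open>enat\<close>: it is attained whenever some
  \<open>N\<close> has the property, and is \<open>\<infinity>\<close> otherwise.\<close>

definition R_sharp :: "nat \<Rightarrow> nat \<Rightarrow> 'a rel \<Rightarrow> enat"
  where "R_sharp k t Q = Inf (enat ` {N. 1 \<le> N \<and>
    (\<forall>\<chi> \<in> tchains (boolean_lattice N) t \<rightarrow> {..<k}.
       \<exists>S \<in> induced_copies Q N. \<exists>a. \<forall>C \<in> tchains (relation_of (\<subseteq>) S) t. \<chi> C = a)})"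

definition f_sharp :: "nat \<Rightarrow> nat \<Rightarrow> nat \<Rightarrow> nat \<Rightarrow> nat"
  where "f_sharp t n p q = (LEAST r. \<exists>\<chi> :: nat set set \<Rightarrow> nat.
    card (\<chi> ` tchains (boolean_lattice n) t) = r \<and>
    (\<forall>S \<in> induced_copies (boolean_lattice p) n.
       q \<le> card (\<chi> ` tchains (relation_of (\<subseteq>) S) t)))"

definition central_binomial :: "nat \<Rightarrow> nat"
  where "central_binomial p = p choose (p div 2)"

text \<open>\<open>c\<close> is a constant for which the upper bound on \<open>f_sharp t n p 2\<close> holds;
  \<open>\<delta>\<close> is the \<open>o(1)\<close> term in the exponent.\<close>

definition upper_bound_constant :: "nat \<Rightarrow> nat \<Rightarrow> real \<Rightarrow> bool"
  where "upper_bound_constant p t c \<longleftrightarrow> 0 < c \<and>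
    (\<exists>\<delta> :: nat \<Rightarrow> real. \<delta> \<longlonglongrightarrow> 0 \<and>
      (\<forall>n\<ge>p. real (f_sharp t n p 2) \<le>
         c * 2 powr ((real n - real p) * real (central_binomial p) * (1 + \<delta> n)
                       / (real (hp p t) - 1))))"

definition R1 :: "nat \<Rightarrow> nat \<Rightarrow> nat \<Rightarrow> real"
  where "R1 k p t = min
    (real p + (real (hp p t) + (real (hp p t) - 1) * log 2 (real k - 1) - 1)
                / (4 * real (central_binomial p)))
    (real p + (real (hp p t) - 1) / (2 * real (central_binomial p)))"

text \<open>The parameter \<open>\<epsilon>\<close> is the \<open>o(1)\<close> term, as a function of \<open>k\<close>.\<close>

definition R2 :: "real \<Rightarrow> (nat \<Rightarrow> real) \<Rightarrow> nat \<Rightarrow> nat \<Rightarrow> nat \<Rightarrow> real"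
  where "R2 c \<epsilon> k p t = real p +
    (real (hp p t) - 1) * (log 2 (real k) - log 2 c) / (real (central_binomial p) * (1 + \<epsilon> k))"

end

theory Submission
  imports Defs
begin

text \<open>
  For the first part, the earlier bound does not grow with the number \<open>k\<close> of colours: one
  of the two terms of the minimum defining \<open>R1\<close> is independent of \<open>k\<close>, and for \<open>k \<ge> 2\<close> both
  terms are at least \<open>p\<close> (\<open>R1_bounds\<close>). The new bound contains \<open>(hp p t - 1) log k\<close> divided
  by a quantity with a positive limit, so it tends to infinity (\<open>R2_tendsto_infinity\<close>) as
  soon as \<open>B\<^sub>p\<close> has two different \<open>t\<close>-chains. This is where \<open>t \<le> p\<close> enters: an initial segment of
  a maximal chain can be shifted by one step (\<open>hp_ge_2\<close>).

  For the second part, the union bound suffices, with \<open>c\<^sub>Q = 1\<close>. Colour the \<open>t\<close>-chains of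
  \<open>B\<^sub>N\<close> uniformly at random with \<open>k\<close> colours. An induced copy of \<open>Q\<close> has exactly \<open>h Q t\<close>
  chains of size \<open>t\<close> (\<open>card_tchains_image\<close>), so it is monochromatic with probability
  \<open>k\<^bsup>1 - h(Q,t)\<^esup>\<close>. There are at most \<open>2\<^bsup>N|Q|\<^esup>\<close> copies, one for each map from
  \<open>Q\<close> to \<open>B\<^sub>N\<close>. If every colouring has a monochromatic copy, then
  \<open>k\<^bsup>h(Q,t) - 1\<^esup> \<le> 2\<^bsup>N|Q|\<^esup>\<close>, and the logarithm of this inequality is the claim. The
  probabilistic argument is carried out by counting colourings
  (\<open>exists_coloring_without_monochromatic\<close>).
\<close>

section \<open>Chains of the Boolean lattice\<close>

lemma tchains_relation_of_subset:
  "tchains (relation_of (\<subseteq>) S) t =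
     {C. C \<subseteq> S \<and> (\<forall>a\<in>C. \<forall>b\<in>C. a \<subseteq> b \<or> b \<subseteq> a) \<and> finite C \<and> card C = t}"
  unfolding tchains_def Chains_def relation_of_def by auto

lemma tchains_subset_Pow_Field: "tchains Q t \<subseteq> Pow (Field Q)"
  unfolding tchains_def Chains_def Field_def by auto

lemma finite_tchains_boolean_lattice: "finite (tchains (boolean_lattice n) t)"
  unfolding boolean_lattice_def tchains_relation_of_subset
  by (rule finite_subset[of _ "Pow (Pow {1..n})"]) auto

lemma tchains_relation_of_mono:
  "S \<subseteq> S' \<Longrightarrow> tchains (relation_of (\<subseteq>) S) t \<subseteq> tchains (relation_of (\<subseteq>) S') t"
  unfolding tchains_relation_of_subset by auto

text \<open>The two chains are \<open>{} \<subset> {1} \<subset> \<dots> \<subset> {1..t-1}\<close> and \<open>{1} \<subset> {1,2} \<subset> \<dots> \<subset> {1..t}\<close>;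
  only the first of them contains the empty set.\<close>
lemma hp_ge_2:
  assumes "1 \<le> t" "t \<le> p"
  shows "2 \<le> hp p t"
proof -
  define seg where "seg I = (\<lambda>i. {1..i}) ` I" for I :: "nat set"
  have inj: "inj (\<lambda>i::nat. {1..i})"
  proof (rule injI)
    fix x y :: nat assume "{1..x} = {1..y}"
    then have "card {1..x} = card {1..y}" by (rule arg_cong)
    then show "x = y" by simp
  qed
  have seg_tchain: "seg I \<in> tchains (boolean_lattice p) t" if "I \<subseteq> {..p}" "card I = t" for I
  proof -
    have "finite I" using finite_subset[OF that(1)] by simp
    moreover have "card (seg I) = t"
      unfolding seg_def using that(2) card_image[OF inj_on_subset[OF inj subset_UNIV[of I]]] by simp
    ultimately show ?thesis
      using that(1) unfolding boolean_lattice_def tchains_relation_of_subset seg_def by auto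
  qed
  have "{} \<in> seg {..<t}"
    unfolding seg_def using assms(1) by (auto intro!: image_eqI[of _ _ 0])
  moreover have "{} \<notin> seg {1..t}" unfolding seg_def by auto
  ultimately have "seg {..<t} \<noteq> seg {1..t}" by metis
  then have "card {seg {..<t}, seg {1..t}} = 2" by simp
  moreover have "{seg {..<t}, seg {1..t}} \<subseteq> tchains (boolean_lattice p) t"
    using assms by (auto intro!: seg_tchain)
  ultimately show ?thesis
    unfolding hp_def h_def using card_mono[OF finite_tchains_boolean_lattice] by metis
qed

section \<open>Growth of the two bounds in the number of colours\<close>

lemma central_binomial_pos: "0 < central_binomial p"
  unfolding central_binomial_def by (simp add: zero_less_binomial)

lemma R1_bounds:
  assumes "2 \<le> k" "1 \<le> hp p t"
  shows "real p \<le> R1 k p t"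
    and "R1 k p t \<le> real p + (real (hp p t) - 1) / (2 * real (central_binomial p))"
proof -
  have "0 \<le> log 2 (real k - 1)" using assms(1) by simp
  then have "0 \<le> (real (hp p t) - 1) * log 2 (real k - 1)"
    using assms(2) by (intro mult_nonneg_nonneg) auto
  then have "0 \<le> real (hp p t) + (real (hp p t) - 1) * log 2 (real k - 1) - 1"
    using assms(2) by simp
  then show "real p \<le> R1 k p t" unfolding R1_def using assms(2) by simp
qed (simp add: R1_def)

text \<open>A factor with the positive limit \<open>(hp p t - 1) / C\<^sub>p\<close> is multiplied by
  \<open>log k - log c\<close>; the error term \<open>\<epsilon>\<close> affects only that factor.\<close>
lemma R2_tendsto_infinity:
  assumes "2 \<le> hp p t" "\<epsilon> \<longlonglongrightarrow> 0"
  shows "filterlim (\<lambda>k. R2 c \<epsilon> k p t) at_top sequentially"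
proof -
  let ?C = "real (central_binomial p)"
  have "filterlim (\<lambda>k. log 2 (real k)) at_top sequentially"
    unfolding log_def
    using filterlim_tendsto_pos_mult_at_top[OF tendsto_const[of "inverse (ln 2)"] _
        filterlim_compose[OF ln_at_top filterlim_real_sequentially]]
    by (simp add: field_simps)
  then have log: "filterlim (\<lambda>k. - log 2 c + log 2 (real k)) at_top sequentially"
    by (rule filterlim_tendsto_add_at_top[OF tendsto_const])
  have "(\<lambda>k. (real (hp p t) - 1) / (?C * (1 + \<epsilon> k))) \<longlonglongrightarrow> (real (hp p t) - 1) / (?C * (1 + 0))"
    using central_binomial_pos[of p] by (intro tendsto_intros assms(2)) auto
  moreover have "0 < (real (hp p t) - 1) / (?C * (1 + 0))"
    using central_binomial_pos[of p] assms(1) by simp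
  ultimately have prod: "filterlim (\<lambda>k. (real (hp p t) - 1) / (?C * (1 + \<epsilon> k)) *
      (- log 2 c + log 2 (real k))) at_top sequentially"
    using log by (rule filterlim_tendsto_pos_mult_at_top)
  show ?thesis
    unfolding R2_def
    using filterlim_tendsto_add_at_top[OF tendsto_const[of "real p"] prod] by (simp add: mult.commute)
qed

proposition R2_improves_R1:
  assumes "2 \<le> p" "1 \<le> t" "t \<le> p" "\<epsilon> \<longlonglongrightarrow> 0"
  shows "filterlim (\<lambda>k. R2 c \<epsilon> k p t / R1 k p t) at_top sequentially"
    and "\<exists>k0. \<forall>k>k0. R1 k p t < R2 c \<epsilon> k p t"
proof -
  define M where "M = real p + (real (hp p t) - 1) / (2 * real (central_binomial p))"
  have hp: "2 \<le> hp p t" using hp_ge_2 assms by simp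
  have M: "0 < M" unfolding M_def using hp assms(1) by (simp add: add_pos_nonneg)
  have bounds: "\<forall>\<^sub>F k in sequentially. 0 < R1 k p t \<and> R1 k p t \<le> M"
    using eventually_ge_at_top[of 2]
  proof eventually_elim
    case (elim k)
    then show ?case using R1_bounds[of k p t] hp assms(1) unfolding M_def by simp
  qed
  have R2: "filterlim (\<lambda>k. R2 c \<epsilon> k p t) at_top sequentially"
    using R2_tendsto_infinity[OF hp assms(4)] .
  have "\<forall>\<^sub>F k in sequentially. M < R2 c \<epsilon> k p t"
    using R2 by (simp add: filterlim_at_top_dense)
  then have "\<forall>\<^sub>F k in sequentially. R1 k p t < R2 c \<epsilon> k p t"
    using bounds by eventually_elim simp
  then show "\<exists>k0. \<forall>k>k0. R1 k p t < R2 c \<epsilon> k p t"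
    unfolding eventually_sequentially by (meson less_imp_le)
  \<comment> \<open>Since \<open>0 < R1 \<le> M\<close> and \<open>R2 > 0\<close> eventually, the quotient dominates \<open>R2 / M\<close>.\<close>
  have "filterlim (\<lambda>k. inverse M * R2 c \<epsilon> k p t) at_top sequentially"
    using M by (intro filterlim_tendsto_pos_mult_at_top[OF tendsto_const _ R2]) simp
  moreover have "\<forall>\<^sub>F k in sequentially. inverse M * R2 c \<epsilon> k p t \<le> R2 c \<epsilon> k p t / R1 k p t"
    using bounds \<open>\<forall>\<^sub>F k in sequentially. M < R2 c \<epsilon> k p t\<close>
  proof eventually_elim
    case (elim k)
    then have "R2 c \<epsilon> k p t / M \<le> R2 c \<epsilon> k p t / R1 k p t"
      using M by (intro divide_left_mono) auto
    then show ?case by (simp add: field_simps)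
  qed
  ultimately show "filterlim (\<lambda>k. R2 c \<epsilon> k p t / R1 k p t) at_top sequentially"
    by (rule filterlim_at_top_mono)
qed

section \<open>The union bound for colourings\<close>

text \<open>A colouring that is constant on \<open>T\<close> is determined by its values outside \<open>T\<close> and at
  one point \<open>x\<close> of \<open>T\<close>, which leaves \<open>|A| - |T| + 1\<close> free values.\<close>
lemma card_monochromatic_le:
  fixes k :: nat
  assumes "finite A" "T \<subseteq> A" "T \<noteq> {}"
  shows "card {\<chi> \<in> A \<rightarrow>\<^sub>E {..<k}. \<exists>a. \<forall>C\<in>T. \<chi> C = a} \<le> k ^ (card A - card T + 1)"
proof -
  obtain x where x: "x \<in> T" using assms(3) by blast
  define D where "D = insert x (A - T)"
  have D: "finite D" "D \<subseteq> A" "card D = card A - card T + 1"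
    unfolding D_def using assms x
    by (auto simp: card_insert_if card_Diff_subset finite_subset)
  let ?M = "{\<chi> \<in> A \<rightarrow>\<^sub>E {..<k}. \<exists>a. \<forall>C\<in>T. \<chi> C = a}"
  have "inj_on (\<lambda>\<chi>. restrict \<chi> D) ?M"
  proof (rule inj_onI)
    fix \<chi> \<psi> assume \<chi>: "\<chi> \<in> ?M" and \<psi>: "\<psi> \<in> ?M" and eq: "restrict \<chi> D = restrict \<psi> D"
    have D_eq: "\<chi> y = \<psi> y" if "y \<in> D" for y
      using eq that by (metis restrict_apply)
    show "\<chi> = \<psi>"
    proof (rule PiE_ext[of _ A "\<lambda>_. {..<k}"])
      fix y assume y: "y \<in> A"
      show "\<chi> y = \<psi> y"
      proof (cases "y \<in> T")
        case True
        then have "\<chi> y = \<chi> x" "\<psi> y = \<psi> x" using \<chi> \<psi> x by auto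
        then show ?thesis using D_eq[of x] by (simp add: D_def)
      next
        case False
        then show ?thesis using D_eq y by (simp add: D_def)
      qed
    qed (use \<chi> \<psi> in auto)
  qed
  moreover have "(\<lambda>\<chi>. restrict \<chi> D) ` ?M \<subseteq> D \<rightarrow>\<^sub>E {..<k}"
    using D(2) by fastforce
  ultimately have "card ?M \<le> card (D \<rightarrow>\<^sub>E {..<k})"
    by (rule card_inj_on_le) (simp add: D(1) finite_PiE)
  also have "\<dots> = k ^ (card A - card T + 1)" by (simp add: card_PiE D)
  finally show ?thesis .
qed

text \<open>Each member of \<open>F\<close> is monochromatic in at most a fraction \<open>k\<^bsup>1 - m\<^esup>\<close> of all
  colourings, so fewer than \<open>k\<^bsup>m - 1\<^esup>\<close> members cannot spoil all of them.\<close>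
lemma exists_coloring_without_monochromatic:
  fixes k m :: nat
  assumes "finite A" "finite F" and F: "\<And>T. T \<in> F \<Longrightarrow> T \<subseteq> A \<and> card T = m"
    and "1 \<le> m" "1 \<le> k" "card F < k ^ (m - 1)"
  shows "\<exists>\<chi> \<in> A \<rightarrow> {..<k}. \<forall>T\<in>F. \<not> (\<exists>a. \<forall>C\<in>T. \<chi> C = a)"
proof (rule ccontr)
  assume contra: "\<not> ?thesis"
  define mono where "mono T = {\<chi> \<in> A \<rightarrow>\<^sub>E {..<k}. \<exists>a. \<forall>C\<in>T. \<chi> C = a}" for T
  have fin: "finite (A \<rightarrow>\<^sub>E {..<k})" using assms(1) by (simp add: finite_PiE)
  have cover: "A \<rightarrow>\<^sub>E {..<k} \<subseteq> (\<Union>T\<in>F. mono T)"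
  proof
    fix \<chi> assume \<chi>: "\<chi> \<in> A \<rightarrow>\<^sub>E {..<k}"
    then have "\<chi> \<in> A \<rightarrow> {..<k}" by auto
    then obtain T where "T \<in> F" "\<exists>a. \<forall>C\<in>T. \<chi> C = a" using contra by blast
    then show "\<chi> \<in> (\<Union>T\<in>F. mono T)" unfolding mono_def using \<chi> by blast
  qed
  have "k ^ card A = card (A \<rightarrow>\<^sub>E {..<k})" using assms(1) by (simp add: card_PiE)
  also have "\<dots> \<le> card (\<Union>T\<in>F. mono T)"
    using cover fin assms(2) by (intro card_mono) (auto simp: mono_def)
  also have "\<dots> \<le> (\<Sum>T\<in>F. card (mono T))" using assms(2) by (rule card_UN_le)
  also have "\<dots> \<le> (\<Sum>T\<in>F. k ^ (card A - m + 1))"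
  proof (rule sum_mono)
    fix T assume "T \<in> F"
    then have "T \<subseteq> A" "card T = m" "T \<noteq> {}" using F[of T] assms(4) by auto
    then show "card (mono T) \<le> k ^ (card A - m + 1)"
      unfolding mono_def using card_monochromatic_le[of A T k] assms(1) by simp
  qed
  finally have le: "k ^ card A \<le> card F * k ^ (card A - m + 1)" by simp
  \<comment> \<open>The inequality itself excludes an empty family, so some \<open>T\<close> gives \<open>m \<le> |A|\<close> and the
    truncated subtraction in the exponent is exact.\<close>
  moreover have "0 < k ^ card A" using assms(5) by simp
  ultimately have "F \<noteq> {}" by auto
  then obtain T where "T \<in> F" by blast
  then have "m \<le> card A" using F[of T] card_mono[OF assms(1), of T] by auto
  then have "card A = (m - 1) + (card A - m + 1)" using assms(4) by simp
  then have "k ^ card A = k ^ (m - 1) * k ^ (card A - m + 1)" by (metis power_add)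
  then have "k ^ (m - 1) \<le> card F" using le assms(5) by simp
  then show False using assms(6) by simp
qed

section \<open>Counting induced copies and the logarithmic bound\<close>

text \<open>A copy is the image of a map from \<open>Q\<close> to the Boolean lattice, and such maps, restricted
  to \<open>Q\<close> to make them finite in number, can be counted.\<close>
lemma card_induced_copies_le:
  assumes "finite (Field Q)"
  shows "finite (induced_copies Q n)" "card (induced_copies Q n) \<le> 2 ^ (n * card (Field Q))"
proof -
  let ?maps = "Field Q \<rightarrow>\<^sub>E Pow {1..n}"
  have fin: "finite ?maps" using assms by (simp add: finite_PiE)
  have sub: "induced_copies Q n \<subseteq> (\<lambda>f. f ` Field Q) ` ?maps"
  proof
    fix S assume "S \<in> induced_copies Q n"
    then obtain f where f: "f \<in> Field Q \<rightarrow> Pow {1..n}" "S = f ` Field Q"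
      unfolding induced_copies_def by blast
    then have "restrict f (Field Q) \<in> ?maps" "S = restrict f (Field Q) ` Field Q" by auto
    then show "S \<in> (\<lambda>f. f ` Field Q) ` ?maps" by blast
  qed
  then show "finite (induced_copies Q n)" using fin finite_surj by blast
  have "card (induced_copies Q n) \<le> card ?maps" using surj_card_le[OF fin sub] .
  also have "\<dots> = (2 ^ n) ^ card (Field Q)" using assms by (simp add: card_PiE card_Pow)
  finally show "card (induced_copies Q n) \<le> 2 ^ (n * card (Field Q))"
    by (simp add: power_mult)
qed

text \<open>An order embedding maps chains to chains of the same size, and the preimage of a chain in
  the image is a chain.\<close>
lemma card_tchains_image:
  assumes inj: "inj_on f (Field Q)"
    and emb: "\<forall>x\<in>Field Q. \<forall>y\<in>Field Q. f x \<subseteq> f y \<longleftrightarrow> (x, y) \<in> Q"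
  shows "card (tchains (relation_of (\<subseteq>) (f ` Field Q)) t) = h Q t"
proof -
  have "(`) f ` tchains Q t = tchains (relation_of (\<subseteq>) (f ` Field Q)) t"
  proof (intro equalityI subsetI)
    fix D assume "D \<in> (`) f ` tchains Q t"
    then obtain C where C: "C \<in> tchains Q t" "D = f ` C" by blast
    then have sub: "C \<subseteq> Field Q" using tchains_subset_Pow_Field by blast
    have "card (f ` C) = card C" using card_image inj_on_subset[OF inj sub] by blast
    then show "D \<in> tchains (relation_of (\<subseteq>) (f ` Field Q)) t"
      using C sub emb unfolding tchains_relation_of_subset
      by (auto simp: tchains_def Chains_def subset_iff)
  next
    fix D assume D: "D \<in> tchains (relation_of (\<subseteq>) (f ` Field Q)) t"
    then obtain C where C: "C \<subseteq> Field Q" "D = f ` C"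
      unfolding tchains_relation_of_subset by (auto simp: subset_image_iff)
    have inj': "inj_on f C" using inj_on_subset[OF inj C(1)] .
    have "finite C" "card C = t"
      using D C(2) inj' unfolding tchains_relation_of_subset
      by (auto simp: card_image dest: finite_imageD)
    moreover have "\<forall>a\<in>C. \<forall>b\<in>C. (a, b) \<in> Q \<or> (b, a) \<in> Q"
    proof (intro ballI)
      fix a b assume ab: "a \<in> C" "b \<in> C"
      then have "f a \<subseteq> f b \<or> f b \<subseteq> f a" using D C(2) unfolding tchains_relation_of_subset by blast
      then show "(a, b) \<in> Q \<or> (b, a) \<in> Q" using emb ab C(1) by blast
    qed
    ultimately show "D \<in> (`) f ` tchains Q t"
      using C(2) unfolding tchains_def Chains_def by auto
  qed
  moreover have "inj_on ((`) f) (tchains Q t)"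
    by (rule inj_on_subset[OF inj_on_image_Pow[OF inj] tchains_subset_Pow_Field])
  ultimately show ?thesis unfolding h_def using card_image by metis
qed

lemma induced_copy_tchains:
  assumes "S \<in> induced_copies Q n"
  shows "tchains (relation_of (\<subseteq>) S) t \<subseteq> tchains (boolean_lattice n) t"
    and "card (tchains (relation_of (\<subseteq>) S) t) = h Q t"
proof -
  obtain f where f: "f \<in> Field Q \<rightarrow> Pow {1..n}" "inj_on f (Field Q)"
    "\<forall>x\<in>Field Q. \<forall>y\<in>Field Q. f x \<subseteq> f y \<longleftrightarrow> (x, y) \<in> Q" "S = f ` Field Q"
    using assms unfolding induced_copies_def by blast
  show "tchains (relation_of (\<subseteq>) S) t \<subseteq> tchains (boolean_lattice n) t"
    unfolding boolean_lattice_def using f(1,4) by (intro tchains_relation_of_mono) auto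
  show "card (tchains (relation_of (\<subseteq>) S) t) = h Q t"
    using card_tchains_image[OF f(2,3)] f(4) by simp
qed

text \<open>Otherwise the copies of \<open>Q\<close> are so few that the union bound, applied to their sets of
  \<open>t\<close>-chains, yields a colouring without a monochromatic copy.\<close>
lemma ramsey_number_colors_le:
  fixes k t :: nat
  assumes "finite (Field Q)" "1 \<le> h Q t" "1 \<le> k"
    and ramsey: "\<forall>\<chi> \<in> tchains (boolean_lattice N) t \<rightarrow> {..<k}.
       \<exists>S \<in> induced_copies Q N. \<exists>a. \<forall>C \<in> tchains (relation_of (\<subseteq>) S) t. \<chi> C = a"
  shows "k ^ (h Q t - 1) \<le> 2 ^ (N * card (Field Q))"
proof (rule ccontr)
  let ?F = "(\<lambda>S. tchains (relation_of (\<subseteq>) S) t) ` induced_copies Q N"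
  assume "\<not> ?thesis"
  moreover have "card ?F \<le> card (induced_copies Q N)"
    by (rule card_image_le) (rule card_induced_copies_le(1)[OF assms(1)])
  ultimately have small: "card ?F < k ^ (h Q t - 1)"
    using card_induced_copies_le(2)[OF assms(1), of N] by linarith
  obtain \<chi> where \<chi>: "\<chi> \<in> tchains (boolean_lattice N) t \<rightarrow> {..<k}"
    "\<forall>T\<in>?F. \<not> (\<exists>a. \<forall>C\<in>T. \<chi> C = a)"
  proof (rule bexE[OF exists_coloring_without_monochromatic[OF finite_tchains_boolean_lattice _ _
          assms(2,3) small]])
    show "finite ?F" using card_induced_copies_le(1)[OF assms(1)] by blast
    show "T \<subseteq> tchains (boolean_lattice N) t \<and> card T = h Q t" if "T \<in> ?F" for T
      using that induced_copy_tchains by blast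
  qed
  obtain S a where "S \<in> induced_copies Q N" "\<forall>C \<in> tchains (relation_of (\<subseteq>) S) t. \<chi> C = a"
    using bspec[OF ramsey \<chi>(1)] by (elim bexE exE)
  then show False using \<chi>(2) by auto
qed

text \<open>If no dimension has the Ramsey property, the infimum is infinite and the bound is trivial;
  otherwise it is attained and the counting inequality holds for it.\<close>
proposition R_sharp_logarithmic_bound:
  fixes k t :: nat
  assumes "finite (Field Q)" "Field Q \<noteq> {}" "1 \<le> h Q t" "1 \<le> k"
  shows "ereal ((real (h Q t) - 1) / real (card (Field Q)) * log 2 (real k))
           \<le> ereal_of_enat (R_sharp k t Q)"
proof -
  define P where "P = {N. 1 \<le> N \<and> (\<forall>\<chi> \<in> tchains (boolean_lattice N) t \<rightarrow> {..<k}.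
       \<exists>S \<in> induced_copies Q N. \<exists>a. \<forall>C \<in> tchains (relation_of (\<subseteq>) S) t. \<chi> C = a)}"
  have R: "R_sharp k t Q = Inf (enat ` P)" unfolding R_sharp_def P_def ..
  show ?thesis
  proof (cases "P = {}")
    case True
    then have "R_sharp k t Q = \<infinity>" unfolding R by (simp add: top_enat_def)
    then show ?thesis by simp
  next
    case False
    then have "Inf (enat ` P) \<in> enat ` P" 
      by (auto simp: Inf_enat_def intro: LeastI)
    then obtain N where N: "N \<in> P" "R_sharp k t Q = enat N" unfolding R by blast
    have "k ^ (h Q t - 1) \<le> 2 ^ (N * card (Field Q))"
      using N(1) unfolding P_def by (intro ramsey_number_colors_le[OF assms(1,3,4)]) blast
    then have "real k ^ (h Q t - 1) \<le> 2 ^ (N * card (Field Q))"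
      by (metis of_nat_le_iff of_nat_numeral of_nat_power)
    then have "log 2 (real k ^ (h Q t - 1)) \<le> log 2 (2 ^ (N * card (Field Q)))"
      using assms(4) by (subst log_le_cancel_iff) auto
    then have "(real (h Q t) - 1) * log 2 (real k) \<le> real N * real (card (Field Q))"
      using assms(3,4) by (simp add: log_nat_power of_nat_diff)
    moreover have "0 < real (card (Field Q))" using assms(1,2) by (simp add: card_gt_0_iff)
    ultimately have "(real (h Q t) - 1) / real (card (Field Q)) * log 2 (real k) \<le> real N"
      by (simp add: field_simps)
    then show ?thesis using N(2) by simp
  qed
qed

theorem proposition6p4:
  shows "(\<forall>p t :: nat. 2 \<le> p \<and> 2 \<le> t \<and> t \<le> p \<longrightarrow>
            (\<forall>c \<epsilon>. upper_bound_constant p t c \<and> \<epsilon> \<longlonglongrightarrow> 0 \<longrightarrow>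
               filterlim (\<lambda>k. R2 c \<epsilon> k p t / R1 k p t) at_top sequentially \<and>
               (\<exists>k0. \<forall>k>k0. R2 c \<epsilon> k p t > R1 k p t)))
       \<and> (\<forall>t\<ge>1. \<forall>Q :: 'a rel.
            Partial_order Q \<and> finite (Field Q) \<and> Field Q \<noteq> {} \<and> 2 \<le> h Q t \<longrightarrow>
            (\<exists>cQ::real. 0 < cQ \<and>
               (\<forall>\<^sub>F k in sequentially.
                  ereal ((real (h Q t) - 1) / real (card (Field Q)) * (log 2 (real k) - log 2 cQ))
                    \<le> ereal_of_enat (R_sharp k t Q))))"
proof (intro conjI allI impI)
  fix p t :: nat and c :: real and \<epsilon> :: "nat \<Rightarrow> real"
  assume "2 \<le> p \<and> 2 \<le> t \<and> t \<le> p" "upper_bound_constant p t c \<and> \<epsilon> \<longlonglongrightarrow> 0"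
  then have pt: "2 \<le> p" "1 \<le> t" "t \<le> p" "\<epsilon> \<longlonglongrightarrow> 0" by auto
  show "filterlim (\<lambda>k. R2 c \<epsilon> k p t / R1 k p t) at_top sequentially"
    using R2_improves_R1(1)[OF pt] .
  show "\<exists>k0. \<forall>k>k0. R1 k p t < R2 c \<epsilon> k p t"
    using R2_improves_R1(2)[OF pt] .
next
  fix t :: nat and Q :: "'a rel"
  assume Q: "Partial_order Q \<and> finite (Field Q) \<and> Field Q \<noteq> {} \<and> 2 \<le> h Q t"
  show "\<exists>cQ::real. 0 < cQ \<and> (\<forall>\<^sub>F k in sequentially.
      ereal ((real (h Q t) - 1) / real (card (Field Q)) * (log 2 (real k) - log 2 cQ))
        \<le> ereal_of_enat (R_sharp k t Q))"
  proof (intro exI[of _ 1] conjI)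
    show "\<forall>\<^sub>F k in sequentially.
      ereal ((real (h Q t) - 1) / real (card (Field Q)) * (log 2 (real k) - log 2 1))
        \<le> ereal_of_enat (R_sharp k t Q)"
      using eventually_ge_at_top[of 1]
    proof eventually_elim
      case (elim k)
      then show ?case using R_sharp_logarithmic_bound[of Q t k] Q by simp
    qed
  qed simp
qed

end
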